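(* Let $Y$ be a real or complex Hausdorff locally convex topological vector space and let $E$ be a closed subset of $Y$ such that $Y\setminus E$ is convex. Let $f,g:X\to Y$ be two functions such that $f(X)\cap E\neq\emptyset$, $f(X)\setminus E\neq\emptyset$ and $g(X)\subseteq Y\setminus E$. Moreover, suppose that one of the two following sets of assumptions holds: $(k_1)$ $X$ is an open set in a Banach space $S$, $\dim(Y)<\infty$ and $f,g$ are the restrictions to $X$ of two continuous linear functions from $S$ into $Y$; $(k_2)$ $X$ is an open set in $\mathbf{C}^n$, $Y=\mathbf{C}$ and $f,g$ are holomorphic in $X$. Then, for every set $D\subseteq[0,1]$ dense in $[0,1]$, with $0\in D$, there exists a set $A\subseteq D$ with the following properties: $(r_1)$ for every $x\in X$, there exists $\lambda\in A$ such that $\lambda g(x)+(1-\lambda)f(x)\in Y\setminus E$; $(r_2)$ for every finite set $B\subseteq A$, there exists $u\in X$ such that $\mu g(u)+(1-\mu)f(u)\in E$ for all $\mu\in B$.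
   Formalization: In (k_2) the open set X is additionally assumed connected; for disconnected X the claim fails, e.g. X={Re x_1<0}∪{Re x_1>0}, E={Re z≤0}, g=1, f=-1 on the first piece and 1 on the second. *)

theory Defs
  imports "HOL-Analysis.Analysis"
begin

(* The scalar field is a type of sort {real_normed_field, euclidean_space}; up to isomorphism
   its only instances are the real and the complex numbers (real_normed_field has a commutative
   multiplication and a multiplicative norm). The real vector space structure supplied by the
   type classes is required to be the restriction of scalars of the given one, so that convex
   and the real coefficients of convex combinations have their usual meaning. *)

locale locally_convex_tvs = vector_space scale
  for scale :: "'k::{real_normed_field,euclidean_space} \<Rightarrow>
      'y::{real_vector,topological_ab_group_add} \<Rightarrow> 'y" +
  assumes scale_of_real: "scale (of_real r) y = r *\<^sub>R y"
    and continuous_scale: "continuous_on UNIV (\<lambda>(c, y). scale c y)"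
    and locally_convex: "\<lbrakk>open (U :: 'y set); 0 \<in> U\<rbrakk> \<Longrightarrow> \<exists>V. open V \<and> convex V \<and> 0 \<in> V \<and> V \<subseteq> U"

locale banach_space_over = vector_space scale
  for scale :: "'k::{real_normed_field,euclidean_space} \<Rightarrow> 's::banach \<Rightarrow> 's" +
  assumes scale_of_real: "scale (of_real r) x = r *\<^sub>R x"
    and norm_scale: "norm (scale c x) = norm c * norm x"

(* Complex Frechet differentiability on an open set of \<complex>\<^sup>n: the derivative is complex linear. *)
definition holomorphic_on_Cn :: "(complex^'n \<Rightarrow> complex) \<Rightarrow> (complex^'n) set \<Rightarrow> bool"
  where "holomorphic_on_Cn f X \<longleftrightarrow>
    (\<forall>x\<in>X. \<exists>L. (f has_derivative L) (at x) \<and> (\<forall>c v. L (c *s v) = c * L v))"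

(* Why the holomorphic case is stated for a connected open set (a domain): for a general open
   set there is a counterexample with functions that are constant on two half-spaces. *)
lemma open_disconnected_counterexample:
  fixes i :: "'n::finite"
  defines "X \<equiv> {x :: complex^'n. Re (x $ i) < 0} \<union> {x. Re (x $ i) > 0}"
    and "E \<equiv> {z :: complex. Re z \<le> 0}"
    and "f \<equiv> \<lambda>x :: complex^'n. if Re (x $ i) < 0 then - 1 else 1 :: complex"
    and "g \<equiv> \<lambda>x :: complex^'n. 1 :: complex"
  shows "open X" "closed E" "convex (- E)" "f ` X \<inter> E \<noteq> {}" "f ` X - E \<noteq> {}" "g ` X \<subseteq> - E"
    "holomorphic_on_Cn f X" "holomorphic_on_Cn g X"
    "\<not> (\<exists>A\<subseteq>{0..1}.
          (\<forall>x\<in>X. \<exists>t\<in>A. t *\<^sub>R g x + (1 - t) *\<^sub>R f x \<in> - E) \<and>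
          (\<forall>B\<subseteq>A. finite B \<longrightarrow> (\<exists>u\<in>X. \<forall>\<mu>\<in>B. \<mu> *\<^sub>R g u + (1 - \<mu>) *\<^sub>R f u \<in> E)))"
proof -
  have o1: "open {x :: complex^'n. Re (x $ i) < 0}" and o2: "open {x :: complex^'n. Re (x $ i) > 0}"
    by (intro open_Collect_less continuous_intros)+
  then show "open X" unfolding X_def by blast
  show "closed E" unfolding E_def by (intro closed_Collect_le continuous_intros)
  have "- E = {z. Re z > 0}" by (auto simp: E_def)
  then show "convex (- E)" using convex_halfspace_Re_gt[of 0] by simp
  have m: "(\<chi> j. - 1) \<in> X" "f (\<chi> j. - 1) = - 1" and p: "(\<chi> j. 1) \<in> X" "f (\<chi> j. 1) = 1"
    by (auto simp: X_def f_def)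
  have "- 1 \<in> f ` X \<inter> E" using imageI[OF m(1), of f] m(2) by (simp add: E_def)
  then show "f ` X \<inter> E \<noteq> {}" by blast
  have "1 \<in> f ` X - E" using imageI[OF p(1), of f] p(2) by (simp add: E_def)
  then show "f ` X - E \<noteq> {}" by blast
  show "g ` X \<subseteq> - E" by (auto simp: g_def E_def)
  show "holomorphic_on_Cn g X"
    unfolding holomorphic_on_Cn_def g_def by (auto intro!: exI[of _ "\<lambda>_. 0"])
  show "holomorphic_on_Cn f X"
    unfolding holomorphic_on_Cn_def
  proof
    fix x assume "x \<in> X"
    then consider "Re (x $ i) < 0" | "Re (x $ i) > 0" by (auto simp: X_def)
    then have "(f has_derivative (\<lambda>_. 0)) (at x)"
    proof cases
      case 1
      show ?thesis
        by (rule has_derivative_transform_within_open[OF has_derivative_const[of "- 1"] o1])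
          (use 1 in \<open>auto simp: f_def\<close>)
    next
      case 2
      show ?thesis
        by (rule has_derivative_transform_within_open[OF has_derivative_const[of 1] o2])
          (use 2 in \<open>auto simp: f_def\<close>)
    qed
    then show "\<exists>L. (f has_derivative L) (at x) \<and> (\<forall>c v. L (c *s v) = c * L v)"
      by (intro exI[of _ "\<lambda>_. 0"]) auto
  qed
  show "\<not> (\<exists>A\<subseteq>{0..1}.
          (\<forall>x\<in>X. \<exists>t\<in>A. t *\<^sub>R g x + (1 - t) *\<^sub>R f x \<in> - E) \<and>
          (\<forall>B\<subseteq>A. finite B \<longrightarrow> (\<exists>u\<in>X. \<forall>\<mu>\<in>B. \<mu> *\<^sub>R g u + (1 - \<mu>) *\<^sub>R f u \<in> E)))"
  proof clarify
    fix A :: "real set"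
    assume r1: "\<forall>x\<in>X. \<exists>t\<in>A. t *\<^sub>R g x + (1 - t) *\<^sub>R f x \<in> - E"
      and r2: "\<forall>B\<subseteq>A. finite B \<longrightarrow> (\<exists>u\<in>X. \<forall>\<mu>\<in>B. \<mu> *\<^sub>R g u + (1 - \<mu>) *\<^sub>R f u \<in> E)"
    from r1 m obtain l where l: "l \<in> A" "2 * l > 1"
      by (fastforce simp: g_def E_def)
    from r2[rule_format, of "{l}"] l obtain u where "u \<in> X" "l *\<^sub>R g u + (1 - l) *\<^sub>R f u \<in> E"
      by auto
    with l show False by (auto simp: f_def g_def E_def split: if_splits)
  qed
qed

end

theory Submission
  imports Defs "HOL-Complex_Analysis.Conformal_Mappings"
begin

text \<open>For each \<open>x\<close> the parameters \<open>t\<close> with \<open>t g(x) + (1 - t) f(x) \<in> E\<close> form a compact initial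
  segment \<open>N x\<close> of \<open>[0,1)\<close>. The set \<open>A = D \<inter> (\<Union>x. N x)\<close> has both properties unless some segment
  \<open>N x\<^sub>0 = [0,\<sigma>]\<close> contains all the others. In that case \<open>h = \<sigma> g + (1 - \<sigma>) f\<close> maps \<open>X\<close> into the
  closure of the open convex set \<open>-E\<close>, attains a boundary value at \<open>x\<^sub>0\<close> and attains an interior
  value as well. This is impossible: if \<open>h\<close> is linear, because \<open>x\<^sub>0\<close> lies strictly between a point of
  \<open>X\<close> with interior value and another point of \<open>X\<close>; if \<open>h\<close> is holomorphic, by the maximum principle
  applied to a functional supporting \<open>-E\<close> at \<open>h(x\<^sub>0)\<close>.\<close>

section \<open>Selection of \<open>A\<close> inside the dense set \<open>D\<close>\<close>

text \<open>The type classes do not link the topology of \<open>'y\<close> to its vector structure,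
  so \<open>cont\<close> supplies continuity along lines. The hypothesis \<open>not_attained\<close>
  isolates what the linear and the holomorphic case prove separately.\<close>

lemma exists_dense_selection:
  fixes f g :: "'x \<Rightarrow> 'y::{real_vector,topological_space}"
  assumes cont: "\<And>u v :: 'y. continuous_on UNIV (\<lambda>t. t *\<^sub>R u + (1 - t) *\<^sub>R v)"
    and E: "closed E" "convex (- E)"
    and D: "D \<subseteq> {0..1}" "{0..1} \<subseteq> closure D" "0 \<in> D"
    and f: "f ` X \<inter> E \<noteq> {}" and g: "g ` X \<subseteq> - E"
    and not_attained: "\<And>\<sigma> x. \<lbrakk>0 \<le> \<sigma>; \<sigma> < 1; x \<in> X; \<sigma> *\<^sub>R g x + (1 - \<sigma>) *\<^sub>R f x \<in> E;
      \<And>y t. \<lbrakk>y \<in> X; \<sigma> < t; t \<le> 1\<rbrakk> \<Longrightarrow> t *\<^sub>R g y + (1 - t) *\<^sub>R f y \<in> - E\<rbrakk> \<Longrightarrow> False"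
  shows "\<exists>A\<subseteq>D. (\<forall>x\<in>X. \<exists>t\<in>A. t *\<^sub>R g x + (1 - t) *\<^sub>R f x \<in> - E) \<and>
    (\<forall>B\<subseteq>A. finite B \<longrightarrow> (\<exists>u\<in>X. \<forall>\<mu>\<in>B. \<mu> *\<^sub>R g u + (1 - \<mu>) *\<^sub>R f u \<in> E))"
proof -
  define N where "N x = {t \<in> {0..1}. t *\<^sub>R g x + (1 - t) *\<^sub>R f x \<in> E}" for x
  have compact_N: "compact (N x)" for x
  proof -
    have "closed ((\<lambda>t::real. t *\<^sub>R g x + (1 - t) *\<^sub>R f x) -` E)"
      using continuous_closed_vimage[OF E(1)] cont continuous_on_eq_continuous_at open_UNIV by blast
    moreover have "N x = {0..1} \<inter> ((\<lambda>t::real. t *\<^sub>R g x + (1 - t) *\<^sub>R f x) -` E)"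
      by (auto simp: N_def)
    ultimately show ?thesis
      by (metis compact_Icc compact_Int_closed)
  qed
  have one: "1 \<notin> N x" if "x \<in> X" for x
    using g that by (auto simp: N_def)
  \<comment> \<open>If the point at \<open>s\<close> lay in the convex set \<open>- E\<close>, then
    so would the whole segment from it to \<open>g x\<close>, and that segment contains the point at
    \<open>t\<close>.\<close>
  have down: "s \<in> N x" if "x \<in> X" "t \<in> N x" "0 \<le> s" "s \<le> t" for s t x
  proof (rule ccontr)
    assume "s \<notin> N x"
    with that have s: "s *\<^sub>R g x + (1 - s) *\<^sub>R f x \<in> - E"
      by (auto simp: N_def)
    from that one have t: "t < 1" "t *\<^sub>R g x + (1 - t) *\<^sub>R f x \<in> E"
      by (force simp: N_def order.order_iff_strict)+
    \<comment> \<open>The weight for which moving from \<open>s\<close> towards 1 ends at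
      \<open>t\<close>: \<open>s + w * (1 - s) = t\<close>.\<close>
    define w where "w = (t - s) / (1 - s)"
    have w: "0 \<le> w" "w \<le> 1" and ws: "w * (1 - s) = t - s"
      using that t by (auto simp: w_def divide_simps)
    have "(1 - w) *\<^sub>R (s *\<^sub>R g x + (1 - s) *\<^sub>R f x) + w *\<^sub>R g x \<in> - E"
      using convexD_alt[OF E(2) s _ w] g that by blast
    moreover have "(1 - w) *\<^sub>R (s *\<^sub>R g x + (1 - s) *\<^sub>R f x) + w *\<^sub>R g x
        = (s + w * (1 - s)) *\<^sub>R g x + (1 - s - w * (1 - s)) *\<^sub>R f x"
      by (simp add: algebra_simps)
    ultimately show False
      using t by (simp add: ws)
  qed
  obtain x1 where x1: "x1 \<in> X" "f x1 \<in> E"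
    using f by blast
  then have zero: "0 \<in> N x1"
    by (simp add: N_def)
  define A where "A = D \<inter> (\<Union>x\<in>X. N x)"
  have "\<exists>t\<in>A. t *\<^sub>R g x + (1 - t) *\<^sub>R f x \<in> - E" if x: "x \<in> X" for x
  proof (rule ccontr)
    assume "\<not> ?thesis"
    then have A_sub: "A \<subseteq> N x"
      using D by (auto simp: A_def N_def)
    have "0 \<in> A"
      using zero x1 D by (auto simp: A_def)
    \<comment> \<open>\<open>N x\<close> is compact, and nonempty because it contains
      \<open>0\<close>, so it has a largest element.\<close>
    then obtain \<sigma> where \<sigma>: "\<sigma> \<in> N x" "\<And>t. t \<in> N x \<Longrightarrow> t \<le> \<sigma>"
      using compact_attains_sup[OF compact_N[of x]] A_sub by blast
    show False
    proof (rule not_attained[OF _ _ x])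
      show "0 \<le> \<sigma>" "\<sigma> *\<^sub>R g x + (1 - \<sigma>) *\<^sub>R f x \<in> E"
        using \<sigma>(1) by (auto simp: N_def)
      show "\<sigma> < 1"
        using \<sigma>(1) one[OF x] by (auto simp: N_def order.order_iff_strict)
      \<comment> \<open>Otherwise density gives some \<open>d\<close> in \<open>D\<close> strictly
        between \<sigma> and \<open>t\<close>; it lies in \<open>N y\<close>, hence in
        \<open>A\<close> and so in \<open>N x\<close>, against the maximality of \<sigma>.\<close>
      show "t *\<^sub>R g y + (1 - t) *\<^sub>R f y \<in> - E" if y: "y \<in> X" and t: "\<sigma> < t" "t \<le> 1" for y t
      proof (rule ccontr)
        assume "\<not> ?thesis"
        with t \<open>0 \<le> \<sigma>\<close> have tN: "t \<in> N y"
          by (auto simp: N_def)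
        have "(\<sigma> + t) / 2 \<in> {\<sigma><..<t} \<inter> closure D"
          using t \<open>0 \<le> \<sigma>\<close> D by auto
        then have "{\<sigma><..<t} \<inter> closure D \<noteq> {}"
          by (metis empty_iff)
        then have "{\<sigma><..<t} \<inter> D \<noteq> {}"
          by (simp add: open_Int_closure_eq_empty)
        then obtain d where d: "d \<in> D" "\<sigma> < d" "d < t"
          by auto
        then have "d \<in> N y"
          using down[OF y tN, of d] \<open>0 \<le> \<sigma>\<close> by simp
        then have "d \<in> N x"
          using A_sub d y by (auto simp: A_def)
        with \<sigma>(2)[of d] d show False
          by simp
      qed
    qed
  qed
  moreover have "\<exists>u\<in>X. \<forall>\<mu>\<in>B. \<mu> *\<^sub>R g u + (1 - \<mu>) *\<^sub>R f u \<in> E" if B: "B \<subseteq> A" "finite B" for B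
  proof (cases "B = {}")
    case True
    then show ?thesis
      using x1 by blast
  next
    case False
    \<comment> \<open>One \<open>u\<close> serves all of \<open>B\<close>: a segment
      \<open>N u\<close> that contains the largest element contains the smaller ones too.\<close>
    then have "Max B \<in> A"
      using B Max_in by blast
    then obtain u where u: "u \<in> X" "Max B \<in> N u"
      by (auto simp: A_def)
    have "\<mu> \<in> N u" if "\<mu> \<in> B" for \<mu>
      using down[OF u, of \<mu>] that B D by (auto simp: A_def)
    then show ?thesis
      using u by (auto simp: N_def)
  qed
  ultimately show ?thesis
    by (intro exI[of _ A]) (auto simp: A_def)
qed

section \<open>The linear case\<close>

text \<open>With \<open>H\<close> the combination at \<sigma> and \<open>x0\<close> strictly between
  \<open>x1\<close> and a point \<open>x2\<close> of \<open>X\<close>, \<open>H x0\<close> is a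
  convex combination of \<open>H x1\<close>, which is in \<open>C\<close>, and \<open>H x2\<close>,
  which is only known to be a limit of points of \<open>C\<close>. A small shift of
  \<open>H x2\<close> into \<open>C\<close> is compensated by an opposite shift of
  \<open>H x1\<close>, which stays in \<open>C\<close> by openness.\<close>

lemma linear_not_attained:
  fixes F G :: "'s::real_normed_vector \<Rightarrow> 'y::{real_vector,topological_space}"
  assumes cont: "\<And>u v :: 'y. continuous_on UNIV (\<lambda>t. t *\<^sub>R u + (1 - t) *\<^sub>R v)"
    and C: "open C" "convex C" and "linear F" "linear G" and "open X"
    and \<sigma>: "0 \<le> \<sigma>" "\<sigma> < 1"
    and C_above: "\<And>y t. \<lbrakk>y \<in> X; \<sigma> < t; t \<le> 1\<rbrakk> \<Longrightarrow> t *\<^sub>R G y + (1 - t) *\<^sub>R F y \<in> C"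
    and "x0 \<in> X" and x1: "x1 \<in> X" "F x1 \<in> C"
  shows "\<sigma> *\<^sub>R G x0 + (1 - \<sigma>) *\<^sub>R F x0 \<in> C"
proof -
  interpret F: linear F by fact
  interpret G: linear G by fact
  define H where "H x = \<sigma> *\<^sub>R G x + (1 - \<sigma>) *\<^sub>R F x" for x
  have "continuous_on UNIV (\<lambda>e::real. x0 + e *\<^sub>R (x0 - x1))"
    by (intro continuous_intros)
  then have "open ((\<lambda>e::real. x0 + e *\<^sub>R (x0 - x1)) -` X)"
    using \<open>open X\<close> open_vimage by blast
  moreover have "0 \<in> (\<lambda>e::real. x0 + e *\<^sub>R (x0 - x1)) -` X"
    using \<open>x0 \<in> X\<close> by simp
  ultimately obtain d where d: "d > 0" "ball 0 d \<subseteq> (\<lambda>e::real. x0 + e *\<^sub>R (x0 - x1)) -` X"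
    by (meson open_contains_ball)
  define e where "e = d / 2"
  define x2 where "x2 = x0 + e *\<^sub>R (x0 - x1)"
  have e: "e > 0"
    using d by (simp add: e_def)
  have "e \<in> ball 0 d"
    using d by (simp add: e_def)
  then have x2: "x2 \<in> X"
    using d unfolding x2_def by blast
  \<comment> \<open>The compensating shift of \<open>H x1\<close>: raising the parameter from
    \<sigma> to \<open>t\<close> at \<open>x2\<close> adds
    \<open>(t - \<sigma>) *\<^sub>R (G x2 - F x2)\<close>, and the division by \<open>e\<close>
    accounts for the weights 1 and \<open>e\<close> of \<open>x2\<close> and
    \<open>x1\<close>.\<close>
  define r where "r t = H x1 - ((t - \<sigma>) / e) *\<^sub>R (G x2 - F x2)" for t
  \<comment> \<open>\<open>r\<close> is affine in \<open>t\<close>, so its continuity is an instance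
    of \<open>cont\<close>.\<close>
  have "r = (\<lambda>t. t *\<^sub>R r 1 + (1 - t) *\<^sub>R r 0)"
  proof
    fix t
    have "t *\<^sub>R r 1 + (1 - t) *\<^sub>R r 0 = (t + (1 - t)) *\<^sub>R H x1
        - (t * ((1 - \<sigma>) / e) + (1 - t) * ((0 - \<sigma>) / e)) *\<^sub>R (G x2 - F x2)"
      unfolding r_def by (simp only: scaleR_add_left scaleR_diff_right scaleR_scaleR) (simp add: algebra_simps)
    moreover have "t * ((1 - \<sigma>) / e) + (1 - t) * ((0 - \<sigma>) / e) = (t - \<sigma>) / e"
      using e by (simp add: field_simps)
    ultimately show "r t = t *\<^sub>R r 1 + (1 - t) *\<^sub>R r 0"
      by (simp only: r_def) simp
  qed
  then have "continuous_on UNIV r"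
    using cont[of "r 1" "r 0"] by metis
  then have "open (r -` C)"
    using C(1) open_vimage by blast
  have "H x1 \<in> C"
    unfolding H_def using convexD[OF C(2) C_above[OF x1(1), of 1] x1(2), of \<sigma> "1 - \<sigma>"] \<sigma> by simp
  then have "\<sigma> \<in> r -` C"
    by (simp add: r_def)
  then obtain b where b: "b > 0" "ball \<sigma> b \<subseteq> r -` C"
    using \<open>open (r -` C)\<close> by (meson open_contains_ball)
  \<comment> \<open>Close enough to \<sigma> for \<open>r t\<close> to stay in \<open>C\<close>, and
    capped at 1 so that \<open>C_above\<close> applies at \<open>x2\<close>.\<close>
  define t where "t = min 1 (\<sigma> + b / 2)"
  have "t \<in> ball \<sigma> b" and t: "\<sigma> < t" "t \<le> 1"
    using b \<sigma> by (auto simp: t_def dist_real_def min_def)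
  then have rt: "r t \<in> C"
    using b by blast
  define p where "p = t *\<^sub>R G x2 + (1 - t) *\<^sub>R F x2"
  have "p \<in> C"
    unfolding p_def by (rule C_above) (use x2 t in auto)
  then have mem: "(1 / (1 + e)) *\<^sub>R p + (e / (1 + e)) *\<^sub>R r t \<in> C"
    using convexD[OF C(2) _ rt] e by (simp add: divide_simps)
  have H2: "p = H x2 + (t - \<sigma>) *\<^sub>R (G x2 - F x2)"
    by (simp add: p_def H_def algebra_simps)
  \<comment> \<open>The two shifts cancel.\<close>
  have "p + e *\<^sub>R r t = H x2 + e *\<^sub>R H x1"
    unfolding H2 r_def using e by (simp add: scaleR_diff_right)
  also have "\<dots> = (1 + e) *\<^sub>R H x0"
    unfolding H_def x2_def by (simp add: F.add F.diff F.scaleR G.add G.diff G.scaleR algebra_simps)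
  finally have "(1 / (1 + e)) *\<^sub>R (p + e *\<^sub>R r t) = (1 / (1 + e)) *\<^sub>R ((1 + e) *\<^sub>R H x0)"
    by simp
  then have "(1 / (1 + e)) *\<^sub>R p + (e / (1 + e)) *\<^sub>R r t = H x0"
    using e by (simp add: scaleR_add_right)
  with mem show ?thesis
    by (simp add: H_def)
qed

section \<open>Holomorphic functions of several variables and their restriction to complex
  lines\<close>

lemma holomorphic_on_Cn_imp_continuous_on: "holomorphic_on_Cn h X \<Longrightarrow> continuous_on X h"
  unfolding holomorphic_on_Cn_def
  by (meson continuous_at_imp_continuous_on has_derivative_continuous)

lemma holomorphic_on_Cn_add:
  assumes "holomorphic_on_Cn f X" "holomorphic_on_Cn g X"
  shows "holomorphic_on_Cn (\<lambda>x. f x + g x) X"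
  unfolding holomorphic_on_Cn_def
proof
  fix x assume "x \<in> X"
  then obtain L M where "(f has_derivative L) (at x)" "\<forall>c v. L (c *s v) = c * L v"
      "(g has_derivative M) (at x)" "\<forall>c v. M (c *s v) = c * M v"
    using assms unfolding holomorphic_on_Cn_def by metis
  then show "\<exists>L. ((\<lambda>x. f x + g x) has_derivative L) (at x) \<and> (\<forall>c v. L (c *s v) = c * L v)"
    by (intro exI[of _ "\<lambda>v. L v + M v"]) (auto intro: has_derivative_add simp: algebra_simps)
qed

lemma holomorphic_on_Cn_scaleR:
  assumes "holomorphic_on_Cn f X"
  shows "holomorphic_on_Cn (\<lambda>x. r *\<^sub>R f x) X"
  unfolding holomorphic_on_Cn_def
proof
  fix x assume "x \<in> X"
  then obtain L where "(f has_derivative L) (at x)" "\<forall>c v. L (c *s v) = c * L v"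
    using assms unfolding holomorphic_on_Cn_def by metis
  then show "\<exists>L. ((\<lambda>x. r *\<^sub>R f x) has_derivative L) (at x) \<and> (\<forall>c v. L (c *s v) = c * L v)"
    by (intro exI[of _ "\<lambda>v. r *\<^sub>R L v"]) (auto intro: has_derivative_scaleR_right)
qed

lemma norm_vector_smult: "norm (c *s v) = norm c * norm v" for v :: "complex^'n"
  by (simp add: norm_vec_def L2_set_right_distrib norm_mult)

lemma bounded_linear_vector_smult_left: "bounded_linear (\<lambda>c. c *s v)" for v :: "complex^'n"
  by (rule bounded_linear_intro[of _ "norm v"])
    (auto simp: vec_eq_iff algebra_simps norm_vector_smult)

text \<open>Reduction to one variable: complex linearity of the derivative \<open>L\<close> turns
  \<open>L (z *s v)\<close> into multiplication of \<open>z\<close> by the number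
  \<open>L v\<close>.\<close>

lemma holomorphic_on_Cn_line:
  assumes "holomorphic_on_Cn h X" and "\<And>z. z \<in> S \<Longrightarrow> x + z *s v \<in> X"
  shows "(\<lambda>z. h (x + z *s v)) holomorphic_on S"
  unfolding holomorphic_on_def
proof (rule ballI, rule field_differentiable_at_within)
  fix z assume "z \<in> S"
  then have "x + z *s v \<in> X"
    by (rule assms(2))
  then obtain L where L: "(h has_derivative L) (at (x + z *s v))" "\<forall>c v. L (c *s v) = c * L v"
    using assms(1) unfolding holomorphic_on_Cn_def by blast
  have "((\<lambda>z. x + z *s v) has_derivative (\<lambda>z. z *s v)) (at z)"
    using has_derivative_add[OF has_derivative_const[of x]
      bounded_linear_imp_has_derivative[OF bounded_linear_vector_smult_left[of v]]] by simp
  from has_derivative_compose[OF this L(1)]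
  have "((\<lambda>z. h (x + z *s v)) has_derivative (*) (L v)) (at z)"
    using L(2) by (simp add: mult.commute[of _ "L v"])
  then show "(\<lambda>z. h (x + z *s v)) field_differentiable (at z)"
    unfolding field_differentiable_def has_field_derivative_def by blast
qed

section \<open>Minimum principle for real linear functionals of holomorphic functions\<close>

text \<open>Since \<open>a \<bullet> k z\<close> is the real part of \<open>cnj a * k z\<close>, the
  function \<open>exp (- (cnj a * k z))\<close> has modulus
  \<open>exp (- (a \<bullet> k z))\<close>. A minimum of the functional is thus a maximum of a
  modulus.\<close>

lemma holomorphic_inner_minimum_principle:
  assumes k: "k holomorphic_on S" and S: "open S" "connected S" "w \<in> S"
    and min: "\<And>z. z \<in> S \<Longrightarrow> a \<bullet> k w \<le> a \<bullet> k z" and z: "z \<in> S"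
  shows "a \<bullet> k z = a \<bullet> k w"
proof -
  let ?q = "\<lambda>z. exp (- (cnj a * k z))"
  have norm_q: "norm (?q z) = exp (- (a \<bullet> k z))" for z
    by (simp add: inner_complex_def)
  have "?q constant_on S"
  proof (rule maximum_modulus_principle[OF _ S(1,2) S(1) order_refl S(3)])
    show "?q holomorphic_on S"
      using k by (intro holomorphic_intros)
    show "norm (?q z) \<le> norm (?q w)" if "z \<in> S" for z
      unfolding norm_q using min[OF that] by simp
  qed
  then have "?q z = ?q w"
    using z S(3) unfolding constant_on_def by metis
  then have "norm (?q z) = norm (?q w)"
    by simp
  then show ?thesis
    unfolding norm_q by simp
qed

text \<open>The set \<open>Z\<close> of minimum points is closed in \<open>X\<close>, and open
  because each point of a small ball around a minimum point is joined to it by a disc in a complex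
  line, where the one-variable principle applies. Connectedness then gives
  \<open>Z = X\<close>.\<close>

lemma holomorphic_on_Cn_inner_minimum_principle:
  assumes h: "holomorphic_on_Cn h X" and X: "open X" "connected X" "x0 \<in> X"
    and min: "\<And>x. x \<in> X \<Longrightarrow> a \<bullet> h x0 \<le> a \<bullet> h x" and x: "x \<in> X"
  shows "a \<bullet> h x = a \<bullet> h x0"
proof -
  define Z where "Z = {x \<in> X. a \<bullet> h x = a \<bullet> h x0}"
  have "continuous_on X (\<lambda>x. a \<bullet> h x)"
    using holomorphic_on_Cn_imp_continuous_on[OF h] by (intro continuous_intros)
  then have closed: "closedin (top_of_set X) Z"
    unfolding Z_def by (rule continuous_closedin_preimage_constant)
  have "open Z"
    unfolding open_contains_ball
  proof
    fix y assume y: "y \<in> Z"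
    then obtain r where r: "r > 0" "ball y r \<subseteq> X"
      using X(1) by (force simp: Z_def open_contains_ball)
    have "y' \<in> Z" if y': "y' \<in> ball y r" for y'
    proof (cases "y' = y")
      case True
      with y show ?thesis by simp
    next
      case False
      define v where "v = y' - y"
      have v: "norm v > 0" "norm v < r"
        using False y' by (auto simp: v_def dist_norm norm_minus_commute)
      \<comment> \<open>The parameters \<open>z\<close> for which \<open>y + z *s v\<close> stays in
        \<open>ball y r\<close>; 1 is among them and leads to \<open>y'\<close>.\<close>
      define S where "S = ball (0::complex) (r / norm v)"
      have line: "y + z *s v \<in> X" if "z \<in> S" for z
      proof -
        have "norm z * norm v < r"
          using that v by (simp add: S_def field_simps)
        then have "y + z *s v \<in> ball y r"
          by (simp add: dist_norm norm_vector_smult)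
        then show ?thesis
          using r by blast
      qed
      have "a \<bullet> h (y + 1 *s v) = a \<bullet> h (y + 0 *s v)"
      proof (rule holomorphic_inner_minimum_principle[where S = S and k = "\<lambda>z. h (y + z *s v)"
              and w = 0 and z = 1])
        show "(\<lambda>z. h (y + z *s v)) holomorphic_on S"
          using holomorphic_on_Cn_line[OF h line] .
        show "a \<bullet> h (y + 0 *s v) \<le> a \<bullet> h (y + z *s v)" if "z \<in> S" for z
          using min[OF line[OF that]] y by (simp add: Z_def)
      qed (use v r in \<open>auto simp: S_def\<close>)
      then show ?thesis
        using y r y' by (auto simp: Z_def v_def)
    qed
    then show "\<exists>r>0. ball y r \<subseteq> Z"
      using r by blast
  qed
  then have "openin (top_of_set X) Z"
    by (simp add: Z_def open_subset)
  with closed X(2,3) have "Z = X"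
    unfolding connected_clopen by (auto simp: Z_def)
  with x show ?thesis
    by (auto simp: Z_def)
qed

section \<open>The holomorphic case\<close>

lemma holomorphic_not_attained:
  fixes f g :: "complex^'n \<Rightarrow> complex"
  assumes C: "open C" "convex C" and X: "open X" "connected X"
    and fg: "holomorphic_on_Cn f X" "holomorphic_on_Cn g X"
    and \<sigma>: "0 \<le> \<sigma>" "\<sigma> < 1"
    and C_above: "\<And>y t. \<lbrakk>y \<in> X; \<sigma> < t; t \<le> 1\<rbrakk> \<Longrightarrow> t *\<^sub>R g y + (1 - t) *\<^sub>R f y \<in> C"
    and x0: "x0 \<in> X" and x1: "x1 \<in> X" "f x1 \<in> C"
  shows "\<sigma> *\<^sub>R g x0 + (1 - \<sigma>) *\<^sub>R f x0 \<in> C"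
proof (rule ccontr)
  define h where "h x = \<sigma> *\<^sub>R g x + (1 - \<sigma>) *\<^sub>R f x" for x
  assume "\<not> ?thesis"
  then have notin: "h x0 \<notin> C"
    by (simp add: h_def)
  have "h x1 \<in> C"
    unfolding h_def using convexD[OF C(2) C_above[OF x1(1), of 1] x1(2), of \<sigma> "1 - \<sigma>"] \<sigma> by simp
  have h: "holomorphic_on_Cn h X"
    unfolding h_def by (intro holomorphic_on_Cn_add holomorphic_on_Cn_scaleR fg)
  \<comment> \<open>A functional supporting \<open>C\<close> at \<open>h x0\<close>, obtained by
    separating \<open>{h x0}\<close> from \<open>C\<close>.\<close>
  obtain a where a: "a \<noteq> 0" "\<And>c. c \<in> C \<Longrightarrow> a \<bullet> h x0 \<le> a \<bullet> c"
  proof -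
    obtain a b where "a \<noteq> 0" "\<forall>x\<in>{h x0}. a \<bullet> x \<le> b" "\<forall>c\<in>C. a \<bullet> c \<ge> b"
      using separating_hyperplane_sets[of "{h x0}" C] C notin \<open>h x1 \<in> C\<close> by auto
    then show thesis
      using that by fastforce
  qed
  \<comment> \<open>\<open>h x\<close> is the limit of points of \<open>C\<close> as
    \<open>t\<close> decreases to \<sigma>, so the supporting inequality extends to all values of
    \<open>h\<close> and \<open>a \<bullet> h\<close> is minimal at \<open>x0\<close>.\<close>
  have "h x \<in> closure C" if "x \<in> X" for x
  proof -
    have "((\<lambda>t. t *\<^sub>R g x + (1 - t) *\<^sub>R f x) \<longlongrightarrow> h x) (at_right \<sigma>)"
      unfolding h_def by (intro tendsto_intros)
    moreover have "\<forall>\<^sub>F t in at_right \<sigma>. t *\<^sub>R g x + (1 - t) *\<^sub>R f x \<in> closure C"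
      using eventually_at_right_less[of \<sigma>] eventually_at_right_real[OF \<sigma>(2)]
      by eventually_elim (use C_above[OF that] closure_subset in force)
    ultimately show ?thesis
      by (rule Lim_in_closed_set[OF closed_closure, rotated 2]) simp_all
  qed
  moreover have "closure C \<subseteq> {c. a \<bullet> h x0 \<le> a \<bullet> c}"
    using a by (intro closure_minimal closed_halfspace_ge) auto
  ultimately have "a \<bullet> h x1 = a \<bullet> h x0"
    using holomorphic_on_Cn_inner_minimum_principle[OF h X x0 _ x1(1)] by blast
  \<comment> \<open>The supporting functional cannot take its minimum at a point of the open set \<open>C\<close>.\<close>
  obtain e where e: "e > 0" "cball (h x1) e \<subseteq> C"
    using C(1) \<open>h x1 \<in> C\<close> by (meson open_contains_cball)
  \<comment> \<open>A step of length exactly \<open>e\<close> against \<open>a\<close>, which lowers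
    the functional by \<open>e * norm a\<close>; the closed ball still contains its end
    point.\<close>
  define c where "c = h x1 - (e / norm a) *\<^sub>R a"
  have "c \<in> C"
    using e a by (intro subsetD[OF e(2)]) (simp add: c_def dist_norm)
  then have "a \<bullet> h x1 \<le> a \<bullet> c"
    using a \<open>a \<bullet> h x1 = a \<bullet> h x0\<close> by simp
  then have "e / norm a * (a \<bullet> a) \<le> 0"
    by (simp add: c_def inner_diff_right)
  moreover have "e / norm a * (a \<bullet> a) > 0"
    using e a by (intro mult_pos_pos) auto
  ultimately show False
    by simp
qed

section \<open>Both cases assembled\<close>

theorem theorem3:
  fixes scaleS :: "'k::{real_normed_field,euclidean_space} \<Rightarrow> 's::banach \<Rightarrow> 's"
    and scaleY :: "'k \<Rightarrow> 'y::{real_vector,topological_ab_group_add,t2_space} \<Rightarrow> 'y"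
    and D :: "real set"
  assumes "D \<subseteq> {0..1}" and "{0..1} \<subseteq> closure D" and "0 \<in> D"
  shows "(\<forall>(E :: 'y set) (X :: 's set) (f :: 's \<Rightarrow> 'y) (g :: 's \<Rightarrow> 'y).
      locally_convex_tvs scaleY \<and>
      closed E \<and> convex (- E) \<and>
      f ` X \<inter> E \<noteq> {} \<and> f ` X - E \<noteq> {} \<and> g ` X \<subseteq> - E \<and>
      banach_space_over scaleS \<and> open X \<and>
      (\<exists>Basis. finite_dimensional_vector_space scaleY Basis) \<and>
      (\<exists>F G. Vector_Spaces.linear scaleS scaleY F \<and> continuous_on UNIV F \<and>
             Vector_Spaces.linear scaleS scaleY G \<and> continuous_on UNIV G \<and>
             (\<forall>x\<in>X. f x = F x \<and> g x = G x))
      \<longrightarrow> (\<exists>A\<subseteq>D.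
            (\<forall>x\<in>X. \<exists>t\<in>A. t *\<^sub>R g x + (1 - t) *\<^sub>R f x \<in> - E) \<and>
            (\<forall>B\<subseteq>A. finite B \<longrightarrow> (\<exists>u\<in>X. \<forall>\<mu>\<in>B. \<mu> *\<^sub>R g u + (1 - \<mu>) *\<^sub>R f u \<in> E)))) \<and>
    (\<forall>(E :: complex set) (X :: (complex^'n) set) (f :: complex^'n \<Rightarrow> complex) (g :: complex^'n \<Rightarrow> complex).
      closed E \<and> convex (- E) \<and>
      f ` X \<inter> E \<noteq> {} \<and> f ` X - E \<noteq> {} \<and> g ` X \<subseteq> - E \<and>
      open X \<and> connected X \<and> holomorphic_on_Cn f X \<and> holomorphic_on_Cn g X
      \<longrightarrow> (\<exists>A\<subseteq>D.
            (\<forall>x\<in>X. \<exists>t\<in>A. t *\<^sub>R g x + (1 - t) *\<^sub>R f x \<in> - E) \<and>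
            (\<forall>B\<subseteq>A. finite B \<longrightarrow> (\<exists>u\<in>X. \<forall>\<mu>\<in>B. \<mu> *\<^sub>R g u + (1 - \<mu>) *\<^sub>R f u \<in> E))))"
proof (intro conjI allI impI; elim conjE exE)
  fix E :: "'y set" and X :: "'s set" and f g :: "'s \<Rightarrow> 'y" and F G
  assume Y: "locally_convex_tvs scaleY" and E: "closed E" "convex (- E)"
    and fE: "f ` X \<inter> E \<noteq> {}" and fC: "f ` X - E \<noteq> {}" and gC: "g ` X \<subseteq> - E"
    and S: "banach_space_over scaleS" and X: "open X"
    and F: "Vector_Spaces.linear scaleS scaleY F" and G: "Vector_Spaces.linear scaleS scaleY G"
    and FG: "\<forall>x\<in>X. f x = F x \<and> g x = G x"
  \<comment> \<open>Linearity over \<open>'k\<close> restricts to real linearity through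
    \<open>of_real\<close>, so the argument over the reals covers both scalar fields.\<close>
  have real_linear: "linear L" if "Vector_Spaces.linear scaleS scaleY L" for L
  proof
    interpret L: Vector_Spaces.linear scaleS scaleY L by fact
    show "L (x + y) = L x + L y" for x y
      by (rule L.add)
    show "L (r *\<^sub>R x) = r *\<^sub>R L x" for r x
      by (metis L.scale banach_space_over.scale_of_real[OF S] locally_convex_tvs.scale_of_real[OF Y])
  qed
  \<comment> \<open>Joint continuity of \<open>scaleY\<close>, composed with \<open>of_real\<close>,
    gives continuity of the real scalar multiplication in its scalar.\<close>
  have scale: "continuous_on UNIV (\<lambda>t. q t *\<^sub>R u)" if "continuous_on UNIV q" for q :: "real \<Rightarrow> real" and u :: 'y
  proof -
    have "continuous_on UNIV (\<lambda>t. (of_real (q t) :: 'k, u))"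
      using that by (intro continuous_intros)
    from continuous_on_compose2[OF locally_convex_tvs.continuous_scale[OF Y] this]
    show ?thesis
      by (simp add: locally_convex_tvs.scale_of_real[OF Y])
  qed
  have cont: "continuous_on UNIV (\<lambda>t. t *\<^sub>R u + (1 - t) *\<^sub>R v)" for u v :: 'y
    by (intro continuous_intros scale)
  obtain x1 where x1: "x1 \<in> X" "f x1 \<in> - E"
    using fC by blast
  show "\<exists>A\<subseteq>D. (\<forall>x\<in>X. \<exists>t\<in>A. t *\<^sub>R g x + (1 - t) *\<^sub>R f x \<in> - E) \<and>
      (\<forall>B\<subseteq>A. finite B \<longrightarrow> (\<exists>u\<in>X. \<forall>\<mu>\<in>B. \<mu> *\<^sub>R g u + (1 - \<mu>) *\<^sub>R f u \<in> E))"
  proof (rule exists_dense_selection[OF cont E assms fE gC])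
    fix \<sigma> x
    assume \<sigma>: "0 \<le> \<sigma>" "\<sigma> < 1" and x: "x \<in> X" "\<sigma> *\<^sub>R g x + (1 - \<sigma>) *\<^sub>R f x \<in> E"
      and above: "\<And>y t. \<lbrakk>y \<in> X; \<sigma> < t; t \<le> 1\<rbrakk> \<Longrightarrow> t *\<^sub>R g y + (1 - t) *\<^sub>R f y \<in> - E"
    have "t *\<^sub>R G y + (1 - t) *\<^sub>R F y \<in> - E" if "y \<in> X" "\<sigma> < t" "t \<le> 1" for y t
      using above[OF that] FG that(1) by simp
    from linear_not_attained[OF cont open_Compl[OF E(1)] E(2) real_linear[OF F] real_linear[OF G]
        X \<sigma> this x(1) x1(1)]
    show False
      using x x1 FG by simp
  qed
next
  fix E :: "complex set" and X :: "(complex^'n) set" and f g :: "complex^'n \<Rightarrow> complex"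
  assume E: "closed E" "convex (- E)"
    and fE: "f ` X \<inter> E \<noteq> {}" and fC: "f ` X - E \<noteq> {}" and gC: "g ` X \<subseteq> - E"
    and X: "open X" "connected X" and fg: "holomorphic_on_Cn f X" "holomorphic_on_Cn g X"
  have cont: "continuous_on UNIV (\<lambda>t. t *\<^sub>R u + (1 - t) *\<^sub>R v)" for u v :: complex
    by (intro continuous_intros)
  obtain x1 where x1: "x1 \<in> X" "f x1 \<in> - E"
    using fC by blast
  show "\<exists>A\<subseteq>D. (\<forall>x\<in>X. \<exists>t\<in>A. t *\<^sub>R g x + (1 - t) *\<^sub>R f x \<in> - E) \<and>
      (\<forall>B\<subseteq>A. finite B \<longrightarrow> (\<exists>u\<in>X. \<forall>\<mu>\<in>B. \<mu> *\<^sub>R g u + (1 - \<mu>) *\<^sub>R f u \<in> E))"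
  proof (rule exists_dense_selection[OF cont E assms fE gC])
    fix \<sigma> x
    assume \<sigma>: "0 \<le> \<sigma>" "\<sigma> < 1" and x: "x \<in> X" "\<sigma> *\<^sub>R g x + (1 - \<sigma>) *\<^sub>R f x \<in> E"
      and above: "\<And>y t. \<lbrakk>y \<in> X; \<sigma> < t; t \<le> 1\<rbrakk> \<Longrightarrow> t *\<^sub>R g y + (1 - t) *\<^sub>R f y \<in> - E"
    from holomorphic_not_attained[OF open_Compl[OF E(1)] E(2) X fg \<sigma> above x(1) x1]
    show False
      using x(2) by simp
  qed
qed

end
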